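(* Let $B\subset\mathbb{R}^d$ ($d\ge2$) be a ball. For every $\gamma<0$ and every $\varepsilon>0$ there exists an open set $\Omega_\varepsilon\subset\mathbb{R}^d$ such that $$|\Omega_\varepsilon\,\Delta\,B|<\varepsilon,\qquad|\Omega_\varepsilon|=|B|,\qquad (P+\gamma E)(\Omega_\varepsilon)<(P+\gamma E)(B).$$
   Context: $|\cdot|$ is Lebesgue measure, $\Delta$ the symmetric difference, $P$ the perimeter, and $E(\Omega)=\min\{\frac12\int_\Omega|\nabla u|^2-\int_\Omega u:\ u\in H^1_0(\Omega)\}$ the Dirichlet energy. *)

theory Defs
  imports "HOL-Analysis.Analysis"
begin

definition partial_deriv :: "'a::euclidean_space \<Rightarrow> ('a \<Rightarrow> real) \<Rightarrow> 'a \<Rightarrow> real" where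
  "partial_deriv b f x = frechet_derivative f (at x) b"

definition grad :: "('a::euclidean_space \<Rightarrow> real) \<Rightarrow> 'a \<Rightarrow> 'a" where
  "grad f x = (\<Sum>b\<in>Basis. partial_deriv b f x *\<^sub>R b)"

definition divergence :: "('a::euclidean_space \<Rightarrow> 'a) \<Rightarrow> 'a \<Rightarrow> real" where
  "divergence F x = (\<Sum>b\<in>Basis. partial_deriv b (\<lambda>y. F y \<bullet> b) x)"

primrec C_k :: "nat \<Rightarrow> ('a::euclidean_space \<Rightarrow> real) \<Rightarrow> bool" where
  "C_k 0 f \<longleftrightarrow> continuous_on UNIV f"
| "C_k (Suc k) f \<longleftrightarrow> (\<forall>x. f differentiable (at x)) \<and> (\<forall>b\<in>Basis. C_k k (partial_deriv b f))"

definition test_functions :: "'a::euclidean_space set \<Rightarrow> ('a \<Rightarrow> real) set" where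
  "test_functions \<Omega> = {\<phi>. (\<forall>k. C_k k \<phi>) \<and> compact (closure {x. \<phi> x \<noteq> 0}) \<and>
     closure {x. \<phi> x \<noteq> 0} \<subseteq> \<Omega>}"

definition test_fields :: "('a::euclidean_space \<Rightarrow> 'a) set" where
  "test_fields = {F. (\<forall>b\<in>Basis. C_k 1 (\<lambda>x. F x \<bullet> b)) \<and> compact (closure {x. F x \<noteq> 0})}"

text \<open>The De Giorgi perimeter in the whole space; it may be infinite, and it does not change
  when the set is modified by a null set.\<close>

definition perimeter :: "'a::euclidean_space set \<Rightarrow> ereal" where
  "perimeter \<Omega> = (SUP F\<in>{F \<in> test_fields. \<forall>x. norm (F x) \<le> 1}.
     ereal (LINT x:\<Omega>|lebesgue. divergence F x))"

text \<open>Elements of Lebesgue and Sobolev spaces are functions rather than classes modulo null sets,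
  and only their values on the underlying set matter.\<close>

definition L2_space :: "'a::euclidean_space set \<Rightarrow> ('a \<Rightarrow> 'b::euclidean_space) set" where
  "L2_space \<Omega> = {f. set_borel_measurable lebesgue \<Omega> f \<and>
     set_integrable lebesgue \<Omega> (\<lambda>x. (norm (f x))\<^sup>2)}"

definition weak_gradient :: "'a::euclidean_space set \<Rightarrow> ('a \<Rightarrow> real) \<Rightarrow> ('a \<Rightarrow> 'a) \<Rightarrow> bool" where
  "weak_gradient \<Omega> u g \<longleftrightarrow> u \<in> L2_space \<Omega> \<and> g \<in> L2_space \<Omega> \<and>
     (\<forall>\<phi>\<in>test_functions \<Omega>. \<forall>b\<in>Basis.
        (LINT x:\<Omega>|lebesgue. u x * partial_deriv b \<phi> x) = - (LINT x:\<Omega>|lebesgue. (g x \<bullet> b) * \<phi> x))"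

text \<open>The closure of the test functions in the norm of \<open>H\<^sup>1\<close>, where \<open>H\<^sup>1(\<Omega>)\<close> consists of
  the \<open>u\<close> with \<open>weak_gradient \<Omega> u g\<close> for some \<open>g\<close>.\<close>

definition H10_space :: "'a::euclidean_space set \<Rightarrow> ('a \<Rightarrow> real) set" where
  "H10_space \<Omega> = {u. \<exists>g. weak_gradient \<Omega> u g \<and>
     (\<exists>\<phi>. (\<forall>n::nat. \<phi> n \<in> test_functions \<Omega>) \<and>
        (\<lambda>n. (LINT x:\<Omega>|lebesgue. (\<phi> n x - u x)\<^sup>2)
           + (LINT x:\<Omega>|lebesgue. (norm (grad (\<phi> n) x - g x))\<^sup>2)) \<longlonglongrightarrow> 0)}"

text \<open>For open sets of finite measure, the only ones on which \<open>LINT x:\<Omega>|lebesgue. u x\<close> is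
  meaningful for every \<open>u\<close> in \<open>H10_space \<Omega>\<close>, the infimum is a minimum. The weak gradient of
  \<open>u\<close> is unique up to null sets, so the value of the functional depends on \<open>u\<close> alone.\<close>

definition dirichlet_energy :: "'a::euclidean_space set \<Rightarrow> ereal" where
  "dirichlet_energy \<Omega> = Inf {ereal (1 / 2 * (LINT x:\<Omega>|lebesgue. (norm (g x))\<^sup>2)
       - (LINT x:\<Omega>|lebesgue. u x)) | u g. u \<in> H10_space \<Omega> \<and> weak_gradient \<Omega> u g}"

end

theory Submission
  imports Defs
begin

text \<open>Subtracting a closed null set from the ball changes neither its volume nor its De Giorgi perimeter,
  but it changes the space \<open>H10_space\<close>, because test functions must vanish near the removed
  set. The ball is cut by the hyperplanes \<open>x \<bullet> b \<in> h \<int>\<close>. Functions that vanish on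
  hyperplanes at distance \<open>h\<close> satisfy a Poincare inequality with a constant of order
  \<open>h\<close>, so the energy of the sliced ball, which is at most \<open>0\<close>, tends to \<open>0\<close> with
  \<open>h\<close>. The energy of the ball itself is strictly negative. As \<open>\<gamma> < 0\<close>, thin slices
  strictly decrease the functional, while the symmetric difference with the ball stays a null set.

  The strict inequality needs three facts. First,
  \<open>perimeter_ball_finite\<close>: the integral over the ball of a partial derivative is a limit of
  integrals of difference quotients, which are controlled by the volume of the symmetric difference
  of the ball and its translates. Second, \<open>dirichlet_energy_ball_neg\<close>: a small multiple of a
  smooth bump has negative energy. Third, \<open>dirichlet_energy_ge\<close>: if \<open>V\<close> has derivative
  \<open>1\<close> in the direction \<open>b\<close> on \<open>\<Omega>\<close> and \<open>|V| \<le> h\<close>, then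
  \<open>\<integral>\<phi> = - \<integral>V \<partial>\<^sub>b \<phi>\<close> for test functions \<open>\<phi>\<close>, and hence
  \<open>\<integral>u \<le> h\<^sup>2 |\<Omega>| / 2 + \<integral>|\<nabla>u|\<^sup>2 / 2\<close> for all \<open>u\<close> in \<open>H10_space \<Omega>\<close>. On the sliced
  ball such a \<open>V\<close> is the distance to the next hyperplane below.\<close>

section \<open>Test functions\<close>

lemma partial_deriv_eq:
  assumes "(f has_derivative f') (at x)"
  shows "partial_deriv b f x = f' b"
  unfolding partial_deriv_def using frechet_derivative_at[OF assms] by simp

text \<open>Smoothness of every order need not be computed derivative by derivative: it is enough to lie in
  some family of differentiable functions that contains all directional derivatives of its members.\<close>

lemma C_k_of_derivative_closed:
  assumes "\<And>f. f \<in> S \<Longrightarrow> \<exists>f'. (\<forall>x. (f has_derivative f' x) (at x)) \<and> (\<forall>v. (\<lambda>x. f' x v) \<in> S)"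
    and "f \<in> S"
  shows "C_k k f"
  using \<open>f \<in> S\<close>
proof (induction k arbitrary: f)
  case 0
  then obtain f' where "\<And>x. (f has_derivative f' x) (at x)"
    using assms(1) by blast
  then show ?case
    by (auto intro!: continuous_at_imp_continuous_on has_derivative_continuous)
next
  case (Suc k)
  then obtain f' where f': "\<And>x. (f has_derivative f' x) (at x)" "\<And>v. (\<lambda>x. f' x v) \<in> S"
    using assms(1) by blast
  have "partial_deriv b f = (\<lambda>x. f' x b)" for b
    using partial_deriv_eq[OF f'(1)] by auto
  with Suc.IH f' show ?case
    by (auto simp: differentiable_def)
qed

text \<open>For \<open>k = 0\<close> this is the classical smooth function that is flat at the origin. The factor
  \<open>inverse t ^ k\<close> makes the derivative of one \<open>flat k\<close> a combination of two others.\<close>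

definition flat :: "nat \<Rightarrow> real \<Rightarrow> real" where
  "flat k t = (if t \<le> 0 then 0 else exp (- inverse t) * inverse t ^ k)"

text \<open>With \<open>s = inverse t\<close> this is the fact that the exponential beats every power.\<close>

lemma flat_tendsto_0: "(flat k \<longlongrightarrow> 0) (at 0)"
proof -
  have "((\<lambda>s::real. s ^ k / exp s) \<longlongrightarrow> 0) at_top"
    by (rule tendsto_power_div_exp_0)
  moreover have "\<forall>\<^sub>F s in at_top. s ^ k / exp s = flat k (inverse s)"
    using eventually_gt_at_top[of "0::real"]
    by eventually_elim (simp add: flat_def exp_minus field_simps)
  ultimately have "((\<lambda>s. flat k (inverse s)) \<longlongrightarrow> 0) at_top"
    using Lim_transform_eventually by fastforce
  then have "(flat k \<longlongrightarrow> 0) (at_right 0)"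
    by (simp add: filterlim_at_right_to_top)
  moreover have "(flat k \<longlongrightarrow> 0) (at_left 0)"
    by (rule tendsto_eventually) (auto simp: flat_def eventually_at_filter)
  ultimately show ?thesis
    by (simp add: filterlim_split_at)
qed

lemma flat_has_derivative:
  "(flat k has_real_derivative flat (k + 2) t - k * flat (k + 1) t) (at t)"
proof -
  consider "t < 0" | "t = 0" | "t > 0" by linarith
  then show ?thesis
  proof cases
    case 1
    have "((\<lambda>_. 0) has_real_derivative 0) (at t)" by simp
    then have "(flat k has_real_derivative 0) (at t)"
      by (rule has_field_derivative_transform_within_open[of _ _ _ "{..<0}"])
        (use 1 in \<open>auto simp: flat_def\<close>)
    then show ?thesis using 1 by (simp add: flat_def)
  next
    case 2
    \<comment> \<open>at the origin the difference quotient of \<open>flat k\<close> is itself \<open>flat (k + 1)\<close>\<close>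
    have "((\<lambda>y. (flat k y - flat k 0) / (y - 0)) \<longlongrightarrow> 0) (at 0)"
      by (rule Lim_transform_eventually[OF flat_tendsto_0[of "k + 1"]])
        (auto simp: flat_def eventually_at_filter divide_inverse)
    then show ?thesis
      using 2 by (simp add: has_field_derivative_iff flat_def)
  next
    case 3
    have "((\<lambda>t. inverse t ^ k) has_real_derivative - (real k * inverse t ^ (k + 1))) (at t)"
    proof (induction k)
      case (Suc k)
      have "((\<lambda>t. inverse t * inverse t ^ k) has_real_derivative
          - (inverse t)\<^sup>2 * inverse t ^ k + - (real k * inverse t ^ (k + 1)) * inverse t) (at t)"
        using 3 DERIV_mult[OF DERIV_inverse Suc] by (simp add: numeral_2_eq_2)
      then show ?case by (simp add: power2_eq_square algebra_simps)
    qed simp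
    moreover have "((\<lambda>t. exp (- inverse t)) has_real_derivative exp (- inverse t) * (inverse t)\<^sup>2) (at t)"
      using 3 by (auto intro!: derivative_eq_intros simp: power2_eq_square)
    ultimately have "((\<lambda>t. exp (- inverse t) * inverse t ^ k) has_real_derivative
        flat (k + 2) t - k * flat (k + 1) t) (at t)"
      using 3 by (auto dest: DERIV_mult simp: flat_def power2_eq_square algebra_simps)
    then show ?thesis
      by (rule has_field_derivative_transform_within_open[of _ _ _ "{0<..}"])
        (use 3 in \<open>auto simp: flat_def\<close>)
  qed
qed

text \<open>The smallest algebra of functions that contains the standard bumps and is closed under directional
  derivatives; the linear functions have to be included because they arise as inner derivatives.
  The sphere of radius \<open>\<rho>\<close> around \<open>a\<close> is where the bumps become flat.\<close>

inductive_set bump_algebra :: "'a::euclidean_space \<Rightarrow> real \<Rightarrow> ('a \<Rightarrow> real) set"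
  for a :: 'a and \<rho> :: real where
  const: "(\<lambda>_. c) \<in> bump_algebra a \<rho>"
| linear: "(\<lambda>x. x \<bullet> v) \<in> bump_algebra a \<rho>"
| bump: "(\<lambda>x. flat k (\<rho>\<^sup>2 - (x - a) \<bullet> (x - a))) \<in> bump_algebra a \<rho>"
| add: "f \<in> bump_algebra a \<rho> \<Longrightarrow> g \<in> bump_algebra a \<rho> \<Longrightarrow> (\<lambda>x. f x + g x) \<in> bump_algebra a \<rho>"
| mult: "f \<in> bump_algebra a \<rho> \<Longrightarrow> g \<in> bump_algebra a \<rho> \<Longrightarrow> (\<lambda>x. f x * g x) \<in> bump_algebra a \<rho>"

lemma bump_algebra_derivative:
  assumes "f \<in> bump_algebra a \<rho>"
  shows "\<exists>f'. (\<forall>x. (f has_derivative f' x) (at x)) \<and> (\<forall>v. (\<lambda>x. f' x v) \<in> bump_algebra a \<rho>)"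
  using assms
proof induction
  case (const c)
  show ?case
    by (rule exI[of _ "\<lambda>x v. 0"]) (auto intro: bump_algebra.const)
next
  case (linear w)
  show ?case
    by (rule exI[of _ "\<lambda>x v. v \<bullet> w"])
      (auto intro!: bump_algebra.const bounded_linear_imp_has_derivative bounded_linear_inner_left)
next
  case (bump k)
  let ?q = "\<lambda>x. \<rho>\<^sup>2 - (x - a) \<bullet> (x - a)"
  let ?f' = "\<lambda>x v. (- 2 * ((x \<bullet> v) + (- (a \<bullet> v)))) *
      (flat (k + 2) (?q x) + (- real k) * flat (k + 1) (?q x))"
  have "((\<lambda>x. flat k (?q x)) has_derivative ?f' x) (at x)" for x
  proof -
    have "(?q has_derivative (\<lambda>v. - 2 * (x \<bullet> v - a \<bullet> v))) (at x)"
      by (auto intro!: derivative_eq_intros simp: fun_eq_iff inner_diff_left inner_diff_right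
          inner_commute algebra_simps)
    from DERIV_compose_FDERIV[OF flat_has_derivative this]
    show ?thesis by simp
  qed
  moreover have "(\<lambda>x. ?f' x v) \<in> bump_algebra a \<rho>" for v
    by (intro bump_algebra.intros)
  ultimately show ?case by (intro exI[of _ ?f']) blast
next
  case (add f g)
  then obtain f' g' where
    "\<forall>x. (f has_derivative f' x) (at x)" "\<forall>v. (\<lambda>x. f' x v) \<in> bump_algebra a \<rho>"
    "\<forall>x. (g has_derivative g' x) (at x)" "\<forall>v. (\<lambda>x. g' x v) \<in> bump_algebra a \<rho>"
    by blast
  then show ?case
    by (intro exI[of _ "\<lambda>x v. f' x v + g' x v"])
      (auto intro!: derivative_intros bump_algebra.add)
next
  case (mult f g)
  then obtain f' g' where fg:
    "\<forall>x. (f has_derivative f' x) (at x)" "\<forall>v. (\<lambda>x. f' x v) \<in> bump_algebra a \<rho>"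
    "\<forall>x. (g has_derivative g' x) (at x)" "\<forall>v. (\<lambda>x. g' x v) \<in> bump_algebra a \<rho>"
    by blast
  then have "((\<lambda>x. f x * g x) has_derivative (\<lambda>v. f x * g' x v + f' x v * g x)) (at x)" for x
    by (intro derivative_intros) auto
  then show ?case
    using mult fg by (intro exI[of _ "\<lambda>x v. f x * g' x v + f' x v * g x"] conjI allI
        bump_algebra.add bump_algebra.mult) auto
qed

lemma exists_positive_test_function:
  fixes a :: "'a::euclidean_space"
  assumes "r > 0"
  obtains \<phi> where "\<And>s. (\<lambda>x. s * \<phi> x) \<in> test_functions (ball a r)"
    and "\<And>x. 0 \<le> \<phi> x" and "\<And>x. dist a x < r / 2 \<Longrightarrow> 0 < \<phi> x"
proof
  let ?\<phi> = "\<lambda>x. flat 0 ((r / 2)\<^sup>2 - (x - a) \<bullet> (x - a))"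
  have sub: "closure {x. s * ?\<phi> x \<noteq> 0} \<subseteq> cball a (r / 2)" for s
  proof (rule closure_minimal)
    show "{x. s * ?\<phi> x \<noteq> 0} \<subseteq> cball a (r / 2)"
    proof safe
      fix x assume "s * ?\<phi> x \<noteq> 0"
      then have "(norm (x - a))\<^sup>2 \<le> (r / 2)\<^sup>2"
        by (simp add: flat_def power2_norm_eq_inner split: if_splits)
      then have "norm (x - a) \<le> r / 2"
        by (rule power2_le_imp_le) (use assms in simp)
      then show "x \<in> cball a (r / 2)"
        by (simp add: dist_norm norm_minus_commute)
    qed
  qed simp
  have "(\<lambda>x. s * ?\<phi> x) \<in> bump_algebra a (r / 2)" for s
    by (rule bump_algebra.mult[OF bump_algebra.const bump_algebra.bump])
  then have "C_k k (\<lambda>x. s * ?\<phi> x)" for k s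
    using C_k_of_derivative_closed[OF bump_algebra_derivative] by metis
  moreover have "compact (closure {x. s * ?\<phi> x \<noteq> 0})" for s
    unfolding compact_eq_bounded_closed by (intro conjI closed_closure bounded_subset[OF bounded_cball sub])
  moreover have "closure {x. s * ?\<phi> x \<noteq> 0} \<subseteq> ball a r" for s
  proof -
    have "cball a (r / 2) \<subseteq> ball a r" using assms by auto
    with sub[of s] show ?thesis by (rule order_trans)
  qed
  ultimately show "(\<lambda>x. s * ?\<phi> x) \<in> test_functions (ball a r)" for s
    by (simp add: test_functions_def)
  show "0 \<le> ?\<phi> x" for x by (simp add: flat_def)
  show "0 < ?\<phi> x" if "dist a x < r / 2" for x
  proof -
    have "(norm (x - a))\<^sup>2 < (r / 2)\<^sup>2"
      using that by (intro power_strict_mono) (auto simp: dist_norm norm_minus_commute)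
    then show ?thesis by (simp add: flat_def power2_norm_eq_inner)
  qed
qed

text \<open>The Frechet derivative is used as the derivative throughout, so that \<open>partial_deriv\<close> is
  literally its value at a basis vector.\<close>

lemma test_function_differentiable:
  assumes "\<phi> \<in> test_functions \<Omega>"
  shows "(\<phi> has_derivative frechet_derivative \<phi> (at x)) (at x)"
proof -
  have "C_k 1 \<phi>" using assms by (simp only: test_functions_def mem_Collect_eq)
  then show ?thesis by (simp add: frechet_derivative_works[symmetric])
qed

lemma test_function_continuous:
  assumes "\<phi> \<in> test_functions \<Omega>"
  shows "continuous_on S \<phi>"
  using has_derivative_continuous[OF test_function_differentiable[OF assms]]
  by (simp add: continuous_at_imp_continuous_on)

lemma partial_deriv_zero_outside_support:
  assumes "x \<notin> closure {x. f x \<noteq> 0}"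
  shows "(f has_derivative (\<lambda>_. 0)) (at x)" and "partial_deriv b f x = 0" and "f x = 0"
proof -
  show "(f has_derivative (\<lambda>_. 0)) (at x)"
    by (rule has_derivative_transform_within_open[of "\<lambda>_. 0" _ _ _ "- closure {x. f x \<noteq> 0}"])
      (use assms closure_subset[of "{x. f x \<noteq> 0}"] in auto)
  from partial_deriv_eq[OF this] show "partial_deriv b f x = 0" .
  show "f x = 0" using assms closure_subset[of "{x. f x \<noteq> 0}"] by auto
qed

lemma partial_deriv_test_function:
  assumes \<phi>: "\<phi> \<in> test_functions \<Omega>" and b: "b \<in> Basis"
  shows "partial_deriv b \<phi> \<in> test_functions \<Omega>"
proof -
  have "C_k k (partial_deriv b \<phi>)" for k
  proof -
    have "C_k (Suc k) \<phi>" using \<phi> unfolding test_functions_def by blast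
    then show ?thesis using b by simp
  qed
  moreover have sub: "closure {x. partial_deriv b \<phi> x \<noteq> 0} \<subseteq> closure {x. \<phi> x \<noteq> 0}"
    by (rule closure_minimal) (use partial_deriv_zero_outside_support(2) in auto)
  moreover have "compact (closure {x. partial_deriv b \<phi> x \<noteq> 0})"
    using \<phi> sub by (auto simp: test_functions_def compact_eq_bounded_closed intro: bounded_subset)
  ultimately show ?thesis
    using \<phi> by (auto simp: test_functions_def)
qed

lemma test_function_zero:
  assumes "\<phi> \<in> test_functions \<Omega>" "x \<notin> \<Omega>"
  shows "\<phi> x = 0"
  using assms closure_subset[of "{x. \<phi> x \<noteq> 0}"] by (auto simp: test_functions_def)

lemma compact_support_bounded:
  fixes f :: "'a::euclidean_space \<Rightarrow> real"
  assumes "continuous_on UNIV f" "bounded {x. f x \<noteq> 0}"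
  obtains M where "M \<ge> 0" "\<And>x. \<bar>f x\<bar> \<le> M"
proof -
  have "compact (closure {x. f x \<noteq> 0})"
    using assms by (simp add: compact_eq_bounded_closed bounded_closure)
  then have "bounded (f ` closure {x. f x \<noteq> 0})"
    using assms(1) by (intro compact_imp_bounded compact_continuous_image)
      (auto intro: continuous_on_subset)
  then obtain M where M: "\<And>x. x \<in> closure {x. f x \<noteq> 0} \<Longrightarrow> \<bar>f x\<bar> \<le> M"
    by (auto simp: bounded_iff)
  have "\<bar>f x\<bar> \<le> \<bar>M\<bar>" for x
    using M[of x] closure_subset[of "{x. f x \<noteq> 0}"] by (cases "f x = 0") force+
  then show thesis by (intro that[of "\<bar>M\<bar>"]) auto
qed

lemma test_function_support_bounded:
  "\<phi> \<in> test_functions \<Omega> \<Longrightarrow> bounded {x. \<phi> x \<noteq> 0}"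
  by (auto simp: test_functions_def compact_eq_bounded_closed intro: bounded_subset[OF _ closure_subset])

lemma test_function_bounded:
  assumes "\<phi> \<in> test_functions \<Omega>"
  obtains M where "M \<ge> 0" "\<And>x. \<bar>\<phi> x\<bar> \<le> M"
  using compact_support_bounded[OF test_function_continuous test_function_support_bounded] assms
  by metis

section \<open>Integrals of derivatives and translations\<close>

lemma lborel_integral_shift:
  fixes f :: "'a::euclidean_space \<Rightarrow> real"
  assumes "f \<in> borel_measurable borel"
  shows "(\<integral>x. f (x + c) \<partial>lborel) = (\<integral>x. f x \<partial>lborel)"
proof -
  have "(\<integral>x. f x \<partial>lborel) = (\<integral>x. f x \<partial>distr lborel borel ((+) c))"
    by (simp add: lborel_distr_plus)
  also have "\<dots> = (\<integral>x. f (c + x) \<partial>lborel)"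
    using assms by (intro integral_distr) auto
  finally show ?thesis by (simp add: add.commute)
qed

lemma integrable_indicator_bounded:
  fixes S :: "'a::euclidean_space set"
  assumes "S \<in> sets borel" "bounded S"
  shows "integrable lborel (indicator S :: 'a \<Rightarrow> real)"
  using assms emeasure_bounded_finite[of S] by (intro integrable_real_indicator) auto

lemma integrable_indicator_times:
  fixes g :: "'a::euclidean_space \<Rightarrow> real"
  assumes S: "S \<in> sets borel" "bounded S"
    and g: "g \<in> borel_measurable borel" "\<And>x. \<bar>g x\<bar> \<le> M"
  shows "integrable lborel (\<lambda>x. indicator S x * g x)"
proof (rule Bochner_Integration.integrable_bound)
  show "integrable lborel (\<lambda>x. M * indicator S x :: real)"
    using S by (intro integrable_mult_right integrable_indicator_bounded)
  have "\<bar>g x\<bar> \<le> \<bar>M\<bar>" for x using g(2)[of x] by linarith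
  then show "AE x in lborel. norm (indicator S x * g x) \<le> norm (M * indicator S x)"
    by (intro AE_I2) (simp add: indicator_def)
  show "(\<lambda>x. indicator S x * g x) \<in> borel_measurable lborel"
    using S(1) g(1) by simp
qed

lemma integrable_bounded_support:
  fixes f :: "'a::euclidean_space \<Rightarrow> real"
  assumes "f \<in> borel_measurable borel" "\<And>x. \<bar>f x\<bar> \<le> M" "\<And>x. R < norm x \<Longrightarrow> f x = 0"
  shows "integrable lborel f"
proof -
  have "integrable lborel (\<lambda>x. indicator (cball 0 R) x * f x)"
    by (rule integrable_indicator_times) (use assms in auto)
  also have "(\<lambda>x. indicator (cball 0 R) x * f x) = f"
    using assms(3) by (intro ext) (auto simp: indicator_def not_le)
  finally show ?thesis .
qed

lemma has_real_derivative_along_line: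
  fixes f :: "'a::real_normed_vector \<Rightarrow> real"
  assumes "\<And>x. (f has_derivative f' x) (at x)"
  shows "((\<lambda>s. f (x + s *\<^sub>R b)) has_real_derivative f' (x + s *\<^sub>R b) b) (at s)"
proof -
  have "((\<lambda>s. f (x + s *\<^sub>R b)) has_derivative (\<lambda>h. f' (x + s *\<^sub>R b) (h *\<^sub>R b))) (at s)"
    by (rule has_derivative_compose[OF _ assms]) (auto intro!: derivative_eq_intros)
  moreover have "f' (x + s *\<^sub>R b) (h *\<^sub>R b) = f' (x + s *\<^sub>R b) b * h" for h
    using has_derivative_bounded_linear[OF assms, of "x + s *\<^sub>R b"]
    by (simp add: linear_cmul bounded_linear.linear)
  ultimately show ?thesis by (simp add: has_field_derivative_def)
qed

lemma difference_quotient_tendsto: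
  fixes f :: "'a::real_normed_vector \<Rightarrow> real"
  assumes "\<And>x. (f has_derivative f' x) (at x)"
  shows "(\<lambda>n. (f (x + inverse (real (Suc n)) *\<^sub>R b) - f x) / inverse (real (Suc n)))
    \<longlonglongrightarrow> f' x b"
proof -
  have "((\<lambda>h. (f (x + h *\<^sub>R b) - f x) / h) \<longlongrightarrow> f' x b) (at 0)"
    using has_real_derivative_along_line[OF assms, of x b 0] by (simp add: has_field_derivative_iff)
  moreover have "filterlim (\<lambda>n. inverse (real (Suc n))) (at 0) sequentially"
    using LIMSEQ_inverse_real_of_nat by (simp add: filterlim_at)
  ultimately show ?thesis by (rule filterlim_compose)
qed

lemma directional_derivative_measurable:
  fixes f :: "'a::euclidean_space \<Rightarrow> real"
  assumes "\<And>x. (f has_derivative f' x) (at x)"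
  shows "(\<lambda>x. f' x b) \<in> borel_measurable borel"
proof (rule borel_measurable_LIMSEQ_real[OF difference_quotient_tendsto[OF assms]])
  have [measurable]: "f \<in> borel_measurable borel"
    using assms by (intro borel_measurable_continuous_onI continuous_at_imp_continuous_on)
      (blast intro: has_derivative_continuous)
  show "(\<lambda>x. (f (x + inverse (real (Suc n)) *\<^sub>R b) - f x) / inverse (real (Suc n)))
      \<in> borel_measurable borel" for n
    by measurable
qed

text \<open>Dominated convergence: by the mean value theorem the difference quotients are bounded by
  \<open>M\<close>, and they vanish outside a ball that exceeds the support by the longest translation.\<close>

lemma integral_difference_quotient_tendsto:
  fixes f :: "'a::euclidean_space \<Rightarrow> real" and b :: 'a and S :: "'a set"
  defines "t \<equiv> \<lambda>n. inverse (real (Suc n))"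
  assumes der: "\<And>x. (f has_derivative f' x) (at x)"
    and bound: "\<And>x. \<bar>f' x b\<bar> \<le> M"
    and supp: "\<And>x. R < norm x \<Longrightarrow> f x = 0"
    and b: "norm b = 1" and S: "S \<in> sets borel"
  shows "(\<lambda>n. \<integral>x. indicator S x * ((f (x + t n *\<^sub>R b) - f x) / t n) \<partial>lborel)
    \<longlonglongrightarrow> (\<integral>x. indicator S x * f' x b \<partial>lborel)"
proof -
  have t: "0 < t n" "t n \<le> 1" for n
    by (auto simp: t_def inverse_le_1_iff)
  have [measurable]: "f \<in> borel_measurable borel"
    using der by (intro borel_measurable_continuous_onI continuous_at_imp_continuous_on)
      (blast intro: has_derivative_continuous)
  have lim: "(\<lambda>n. (f (x + t n *\<^sub>R b) - f x) / t n) \<longlonglongrightarrow> f' x b" for x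
    unfolding t_def by (rule difference_quotient_tendsto[OF der])
  have [measurable]: "(\<lambda>x. f' x b) \<in> borel_measurable borel"
    by (rule directional_derivative_measurable[OF der])
  have quot: "\<bar>(f (x + t n *\<^sub>R b) - f x) / t n\<bar> \<le> M" for x n
  proof -
    obtain z where "f (x + t n *\<^sub>R b) - f (x + 0 *\<^sub>R b) = (t n - 0) * f' (x + z *\<^sub>R b) b"
      using MVT2[OF t(1), where f = "\<lambda>s. f (x + s *\<^sub>R b)" and f' = "\<lambda>s. f' (x + s *\<^sub>R b) b"]
        has_real_derivative_along_line[OF der] by metis
    then show ?thesis using bound[of "x + z *\<^sub>R b"] t(1)[of n] by simp
  qed
  have quot0: "(f (x + t n *\<^sub>R b) - f x) / t n = 0" if "R + 1 < norm x" for x n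
  proof -
    have "norm x \<le> norm (x + t n *\<^sub>R b) + norm (t n *\<^sub>R b)"
      by (metis add_diff_cancel_right' norm_triangle_ineq4)
    then have "R < norm (x + t n *\<^sub>R b)"
      using that t[of n] b by simp
    then show ?thesis using that supp by simp
  qed
  show ?thesis
  proof (rule integral_dominated_convergence[where w = "\<lambda>x. M * indicator (cball 0 (R + 1)) x"])
    show "integrable lborel (\<lambda>x::'a. M * indicator (cball 0 (R + 1)) x :: real)"
      by (intro integrable_mult_right integrable_indicator_bounded) auto
    show "AE x in lborel. norm (indicator S x * ((f (x + t n *\<^sub>R b) - f x) / t n))
        \<le> M * indicator (cball 0 (R + 1)) x" for n
    proof (rule AE_I2)
      fix x :: 'a
      have "0 \<le> M" using bound[of 0] by linarith
      then show "norm (indicator S x * ((f (x + t n *\<^sub>R b) - f x) / t n))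
        \<le> M * indicator (cball 0 (R + 1)) x"
        using quot[of x n] quot0[of x n] by (auto simp: indicator_def)
    qed
    show "AE x in lborel. (\<lambda>n. indicator S x * ((f (x + t n *\<^sub>R b) - f x) / t n))
        \<longlonglongrightarrow> indicator S x * f' x b"
      by (intro AE_I2 tendsto_mult_left lim)
  qed (use S in simp_all)
qed

text \<open>Translations preserve the integral, so the integrals of all difference quotients vanish, and so
  does their limit. This takes the place of Fubini and the fundamental theorem of calculus.\<close>

lemma integral_derivative_eq_0:
  fixes f :: "'a::euclidean_space \<Rightarrow> real"
  assumes der: "\<And>x. (f has_derivative f' x) (at x)"
    and bound: "\<And>x. \<bar>f' x b\<bar> \<le> M"
    and supp: "bounded {x. f x \<noteq> 0}"
    and b: "norm b = 1"
  shows "(\<integral>x. f' x b \<partial>lebesgue) = 0"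
proof -
  obtain R where R: "\<And>x. f x \<noteq> 0 \<Longrightarrow> norm x \<le> R"
    using supp by (auto simp: bounded_iff)
  have cont: "continuous_on UNIV f"
    using der by (intro continuous_at_imp_continuous_on) (blast intro: has_derivative_continuous)
  then have [measurable]: "f \<in> borel_measurable borel"
    by (rule borel_measurable_continuous_onI)
  obtain C where "\<And>x. \<bar>f x\<bar> \<le> C"
    using compact_support_bounded[OF cont supp] by blast
  with R have int: "integrable lborel f"
    by (intro integrable_bounded_support[of f C R]) (auto simp: not_le[symmetric])
  have shift: "integrable lborel (\<lambda>x. f (x + c))" "(\<integral>x. f (x + c) - f x \<partial>lborel) = 0" for c
  proof -
    have "integrable (distr lborel borel ((+) c)) f"
      using int by (simp add: lborel_distr_plus)
    then show i: "integrable lborel (\<lambda>x. f (x + c))"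
      by (subst (asm) integrable_distr_eq) (auto simp: add.commute)
    show "(\<integral>x. f (x + c) - f x \<partial>lborel) = 0"
      using i int by (simp add: lborel_integral_shift)
  qed
  have "(\<lambda>n::nat. 0) \<longlonglongrightarrow> (\<integral>x. f' x b \<partial>lborel)"
    using integral_difference_quotient_tendsto[OF der bound, of R UNIV] R b
    by (simp add: shift not_le[symmetric]) blast
  then have "(\<integral>x. f' x b \<partial>lborel) = 0"
    by (simp add: LIMSEQ_const_iff)
  moreover have "(\<lambda>x. f' x b) \<in> borel_measurable borel"
    by (rule directional_derivative_measurable[OF der])
  ultimately show ?thesis by (simp add: integral_completion)
qed

section \<open>Perimeter\<close>

lemma perimeter_cong_null:
  assumes A: "A \<in> sets lebesgue" and B: "B \<in> sets lebesgue"
    and null: "negligible (sym_diff A B)"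
  shows "perimeter A = perimeter B"
proof -
  have "(LINT x:A|lebesgue. divergence F x) = (LINT x:B|lebesgue. divergence F x)"
    if F: "F \<in> test_fields" for F :: "'a \<Rightarrow> 'a"
  proof (rule set_integral_cong_set[symmetric])
    have "continuous_on UNIV (divergence F)"
      using F unfolding test_fields_def divergence_def by (auto intro!: continuous_on_sum)
    then have "divergence F \<in> borel_measurable lebesgue"
      by (intro measurable_completion) (simp add: borel_measurable_continuous_onI)
    then show "set_borel_measurable lebesgue A (divergence F)"
      "set_borel_measurable lebesgue B (divergence F)"
      using A B by (auto simp: set_borel_measurable_def)
    show "AE x in lebesgue. (x \<in> A) = (x \<in> B)"
      by (rule AE_I'[of "sym_diff A B"]) (use null in \<open>auto simp: negligible_iff_null_sets\<close>)
  qed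
  then show ?thesis
    unfolding perimeter_def by (intro SUP_cong) auto
qed

text \<open>Shifting the function against the ball is the same as shifting the ball. The ball and its
  translate by \<open>t\<close> differ only inside the annulus with radii \<open>r - t\<close> and
  \<open>r + t\<close>, so the difference quotients are at most the volume of that annulus divided by
  \<open>t\<close>. The constant \<open>K\<close> is the limit of this ratio, namely the derivative at
  \<open>0\<close> of the volume of the annulus.\<close>

lemma abs_integral_derivative_ball_le:
  fixes f :: "'a::euclidean_space \<Rightarrow> real" and a b :: 'a and r :: real
  defines "K \<equiv> 2 * real DIM('a) * r ^ (DIM('a) - 1) * measure lborel (ball (0::'a) 1)"
  assumes der: "\<And>x. (f has_derivative f' x) (at x)"
    and bound: "\<And>x. \<bar>f' x b\<bar> \<le> M"
    and supp: "bounded {x. f x \<noteq> 0}"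
    and f1: "\<And>x. \<bar>f x\<bar> \<le> 1"
    and b: "norm b = 1" and r: "0 < r"
  shows "\<bar>\<integral>x. indicator (ball a r) x * f' x b \<partial>lborel\<bar> \<le> K"
proof -
  define t where "t = (\<lambda>n. inverse (real (Suc n)))"
  have t: "0 < t n" for n by (simp add: t_def)
  have t0: "t \<longlonglongrightarrow> 0"
    unfolding t_def by (rule LIMSEQ_inverse_real_of_nat)
  obtain R where R: "\<And>x. f x \<noteq> 0 \<Longrightarrow> norm x \<le> R"
    using supp by (auto simp: bounded_iff)
  have cont: "continuous_on UNIV f"
    using der by (intro continuous_at_imp_continuous_on) (blast intro: has_derivative_continuous)
  then have [measurable]: "f \<in> borel_measurable borel"
    by (rule borel_measurable_continuous_onI)
  let ?B = "\<lambda>s. ball a s"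
  let ?I = "\<lambda>n. \<integral>x. indicator (?B r) x * ((f (x + t n *\<^sub>R b) - f x) / t n) \<partial>lborel"
  have "?I \<longlonglongrightarrow> (\<integral>x. indicator (?B r) x * f' x b \<partial>lborel)"
    unfolding t_def using R b by (intro integral_difference_quotient_tendsto[OF der bound, where R = R]) force+
  then have lim: "(\<lambda>n. \<bar>?I n\<bar>) \<longlonglongrightarrow> \<bar>\<integral>x. indicator (?B r) x * f' x b \<partial>lborel\<bar>"
    by (rule tendsto_rabs)
  have intB: "integrable lborel (indicator (?B s) :: 'a \<Rightarrow> real)" for s
    by (intro integrable_indicator_bounded) auto
  have le: "\<bar>?I n\<bar> \<le> (measure lborel (?B (r + t n)) - measure lborel (?B (r - t n))) / t n" for n
  proof -
    let ?c = "t n *\<^sub>R b"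
    let ?g = "\<lambda>x. (indicator (?B r) (x - ?c) - indicator (?B r) x) * f x"
    have ball_shift: "indicator (?B r) (x - ?c) = (indicator (ball (a + ?c) r) x :: real)" for x
      by (simp add: indicator_def dist_norm algebra_simps)
    have int1: "integrable lborel (\<lambda>x. indicator (?B r) x * f x)"
      using f1 by (intro integrable_indicator_times) auto
    have int2: "integrable lborel (\<lambda>x. indicator (?B r) x * f (x + ?c))"
      using f1 by (intro integrable_indicator_times) auto
    have int3: "integrable lborel (\<lambda>x. indicator (?B r) (x - ?c) * f x)"
      unfolding ball_shift using f1 by (intro integrable_indicator_times) auto
    have "?I n = (\<integral>x. (indicator (?B r) x * f (x + ?c) - indicator (?B r) x * f x) / t n \<partial>lborel)"
      by (intro Bochner_Integration.integral_cong) (auto simp: algebra_simps diff_divide_distrib)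
    also have "\<dots> = ((\<integral>x. indicator (?B r) x * f (x + ?c) \<partial>lborel) - (\<integral>x. indicator (?B r) x * f x \<partial>lborel)) / t n"
      using int1 int2 by simp
    also have "(\<integral>x. indicator (?B r) x * f (x + ?c) \<partial>lborel) = (\<integral>x. indicator (?B r) (x - ?c) * f x \<partial>lborel)"
      using lborel_integral_shift[of "\<lambda>x. indicator (?B r) (x - ?c) * f x" ?c]
        borel_measurable_integrable[OF int3] by simp
    also have "\<dots> - (\<integral>x. indicator (?B r) x * f x \<partial>lborel) = (\<integral>x. ?g x \<partial>lborel)"
      using int1 int3 by (simp add: left_diff_distrib)
    finally have eq: "\<bar>?I n\<bar> = \<bar>\<integral>x. ?g x \<partial>lborel\<bar> / t n"
      using t[of n] by simp
    have ptw: "\<bar>?g x\<bar> \<le> indicator (?B (r + t n)) x - indicator (?B (r - t n)) x" for x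
    proof -
      have "norm ?c = t n" using b t[of n] by simp
      then have "\<bar>dist a (x - ?c) - dist a x\<bar> \<le> t n"
        using norm_triangle_ineq3[of "a - (x - ?c)" "a - x"] by (simp add: dist_norm)
      then have le: "\<bar>indicator (?B r) (x - ?c) - indicator (?B r) x\<bar>
          \<le> (indicator (?B (r + t n)) x - indicator (?B (r - t n)) x :: real)"
        using t[of n] by (auto simp: indicator_def)
      have "\<bar>?g x\<bar> \<le> \<bar>indicator (?B r) (x - ?c) - indicator (?B r) x\<bar>"
        unfolding abs_mult using f1 by (intro mult_left_le) auto
      with le show ?thesis by (rule order_trans[rotated])
    qed
    have "\<bar>\<integral>x. ?g x \<partial>lborel\<bar> \<le> (\<integral>x. \<bar>?g x\<bar> \<partial>lborel)"
      by (rule integral_abs_bound)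
    also have "\<dots> \<le> (\<integral>x. indicator (?B (r + t n)) x - indicator (?B (r - t n)) x \<partial>lborel)"
      using int1 int3 intB ptw
      by (intro integral_mono) (auto simp: left_diff_distrib intro!: integrable_abs)
    also have "\<dots> = measure lborel (?B (r + t n)) - measure lborel (?B (r - t n))"
      using intB by simp
    finally show ?thesis
      unfolding eq using t[of n] by (simp add: divide_right_mono)
  qed
  let ?\<omega> = "measure lborel (ball (0::'a) 1)"
  let ?V = "\<lambda>s. ((r + s) ^ DIM('a) - (r - s) ^ DIM('a)) * ?\<omega>"
  have "(?V has_real_derivative K) (at 0)"
    unfolding K_def by (auto intro!: derivative_eq_intros)
  then have "((\<lambda>h. ?V h / h) \<longlongrightarrow> K) (at 0)"
    by (simp add: has_field_derivative_iff)
  moreover have "filterlim t (at 0) sequentially"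
    using t0 t by (simp add: filterlim_at less_imp_neq[symmetric])
  ultimately have "(\<lambda>n. ?V (t n) / t n) \<longlonglongrightarrow> K"
    by (rule filterlim_compose)
  moreover have "\<forall>\<^sub>F n in sequentially. t n < r"
    using t0 r by (rule order_tendstoD)
  then have "\<forall>\<^sub>F n in sequentially. \<bar>?I n\<bar> \<le> ?V (t n) / t n"
  proof eventually_elim
    case (elim n)
    have "measure lborel (?B (r + t n)) - measure lborel (?B (r - t n)) = ?V (t n)"
      using elim t[of n] r content_ball_conv_unit_ball[of "r + t n" a]
        content_ball_conv_unit_ball[of "r - t n" a]
      by (simp add: left_diff_distrib)
    then show ?case
      using le[of n] by (simp only:)
  qed
  ultimately show ?thesis
    using lim by (intro tendsto_le[OF trivial_limit_sequentially])
qed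

text \<open>Finiteness of the perimeter is what turns a strict inequality between energies
  into a strict inequality between the functionals. The bound adds up the estimates for the
  components of a field, which is wasteful by a factor depending on the dimension.\<close>

lemma perimeter_ball_finite:
  fixes a :: "'a::euclidean_space"
  assumes "0 < r"
  shows "\<bar>perimeter (ball a r)\<bar> \<noteq> \<infinity>"
proof -
  define K where "K = 2 * real DIM('a) * r ^ (DIM('a) - 1) * measure lborel (ball (0::'a) 1)"
  have "(LINT x:ball a r|lebesgue. divergence F x) \<le> DIM('a) * K"
    if F: "F \<in> test_fields" and F1: "\<forall>x. norm (F x) \<le> 1" for F :: "'a \<Rightarrow> 'a"
  proof -
    let ?p = "\<lambda>b x. partial_deriv b (\<lambda>y. F y \<bullet> b) x"
    have dif: "((\<lambda>y. F y \<bullet> b) has_derivative frechet_derivative (\<lambda>y. F y \<bullet> b) (at x)) (at x)"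
      and cont: "continuous_on UNIV (?p b)" if "b \<in> Basis" for b x
      using F that by (auto simp: test_fields_def frechet_derivative_works[symmetric])
    have supp: "bounded {x. F x \<noteq> 0}"
      using F by (auto simp: test_fields_def compact_eq_bounded_closed intro: bounded_subset[OF _ closure_subset])
    then have suppb: "bounded {x. F x \<bullet> b \<noteq> 0}" for b
      by (rule bounded_subset) auto
    have bd: "\<exists>M. \<forall>x. \<bar>?p b x\<bar> \<le> M" if b: "b \<in> Basis" for b
    proof -
      have "bounded {x. ?p b x \<noteq> 0}"
      proof (rule bounded_subset)
        show "bounded (closure {x. F x \<bullet> b \<noteq> 0})" by (intro bounded_closure suppb)
        show "{x. ?p b x \<noteq> 0} \<subseteq> closure {x. F x \<bullet> b \<noteq> 0}"
          using partial_deriv_zero_outside_support(2)[of _ "\<lambda>y. F y \<bullet> b"] by blast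
      qed
      then show ?thesis using compact_support_bounded[OF cont[OF b]] by metis
    qed
    have le: "\<bar>\<integral>x. indicator (ball a r) x * ?p b x \<partial>lborel\<bar> \<le> K" if b: "b \<in> Basis" for b
    proof -
      obtain M where "\<And>x. \<bar>?p b x\<bar> \<le> M" using bd[OF b] by blast
      moreover have "\<bar>F x \<bullet> b\<bar> \<le> 1" for x
        using Basis_le_norm[OF b, of "F x"] F1 by (meson order_trans)
      ultimately show ?thesis
        unfolding K_def partial_deriv_def
        by (intro abs_integral_derivative_ball_le[OF dif[OF b] _ suppb]) (use b assms in auto)
    qed
    have int: "integrable lborel (\<lambda>x. indicator (ball a r) x * ?p b x)" if b: "b \<in> Basis" for b
    proof -
      obtain M where "\<And>x. \<bar>?p b x\<bar> \<le> M" using bd[OF b] by blast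
      then show ?thesis
        using cont[OF b] by (intro integrable_indicator_times borel_measurable_continuous_onI) auto
    qed
    have "(LINT x:ball a r|lebesgue. divergence F x)
        = (\<integral>x. (\<Sum>b\<in>Basis. indicator (ball a r) x * ?p b x) \<partial>lebesgue)"
      by (simp add: set_lebesgue_integral_def divergence_def sum_distrib_left)
    also have "\<dots> = (\<integral>x. (\<Sum>b\<in>Basis. indicator (ball a r) x * ?p b x) \<partial>lborel)"
      using int by (intro integral_completion borel_measurable_integrable Bochner_Integration.integrable_sum)
    also have "\<dots> = (\<Sum>b\<in>Basis. \<integral>x. indicator (ball a r) x * ?p b x \<partial>lborel)"
      using int by (rule Bochner_Integration.integral_sum)
    also have "\<dots> \<le> (\<Sum>b\<in>(Basis::'a set). K)"
      using le by (intro sum_mono) (meson abs_le_D1)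
    finally show ?thesis by simp
  qed
  then have "perimeter (ball a r) \<le> ereal (DIM('a) * K)"
    unfolding perimeter_def by (intro SUP_least) auto
  moreover have "ereal 0 \<le> perimeter (ball a r)"
  proof -
    have d0: "partial_deriv b (\<lambda>_. 0) = (\<lambda>_. 0)" for b :: 'a
      using partial_deriv_eq[OF has_derivative_const] by auto
    have "(\<lambda>_. 0) \<in> {F::'a \<Rightarrow> 'a. F \<in> test_fields \<and> (\<forall>x. norm (F x) \<le> 1)}"
      by (auto simp: test_fields_def d0)
    moreover have "(LINT x:ball a r|lebesgue. divergence (\<lambda>_. 0) x) = 0"
      by (simp add: divergence_def d0)
    ultimately show ?thesis
      unfolding perimeter_def by (metis (mono_tags, lifting) SUP_upper)
  qed
  ultimately show ?thesis by auto
qed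

section \<open>Square-integrable functions\<close>

lemma integrable_mult_L2:
  fixes f g :: "'a \<Rightarrow> real"
  assumes [measurable]: "f \<in> borel_measurable M" "g \<in> borel_measurable M"
    and "integrable M (\<lambda>x. (f x)\<^sup>2)" "integrable M (\<lambda>x. (g x)\<^sup>2)"
  shows "integrable M (\<lambda>x. f x * g x)"
proof (rule Bochner_Integration.integrable_bound)
  show "integrable M (\<lambda>x. (f x)\<^sup>2 + (g x)\<^sup>2)" using assms by simp
  have "\<bar>p * q\<bar> \<le> p\<^sup>2 + q\<^sup>2" for p q :: real
  proof -
    have "2 * \<bar>p * q\<bar> \<le> p\<^sup>2 + q\<^sup>2"
      using sum_squares_bound[of "\<bar>p\<bar>" "\<bar>q\<bar>"] by (simp add: abs_mult)
    then show ?thesis using abs_ge_zero[of "p * q"] by linarith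
  qed
  then show "AE x in M. norm (f x * g x) \<le> norm ((f x)\<^sup>2 + (g x)\<^sup>2)"
    by (intro AE_I2) simp
qed measurable

lemma integrable_diff_L2:
  fixes f g :: "'a \<Rightarrow> 'b::euclidean_space"
  assumes [measurable]: "f \<in> borel_measurable M" "g \<in> borel_measurable M"
    and "integrable M (\<lambda>x. (norm (f x))\<^sup>2)" "integrable M (\<lambda>x. (norm (g x))\<^sup>2)"
  shows "integrable M (\<lambda>x. (norm (f x - g x))\<^sup>2)"
proof (rule Bochner_Integration.integrable_bound)
  show "integrable M (\<lambda>x. 2 * (norm (f x))\<^sup>2 + 2 * (norm (g x))\<^sup>2)" using assms by simp
  have "(norm (p - q))\<^sup>2 \<le> 2 * (norm p)\<^sup>2 + 2 * (norm q)\<^sup>2" for p q :: 'b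
  proof -
    have "(norm (p - q))\<^sup>2 \<le> (norm p + norm q)\<^sup>2"
      by (intro power_mono norm_triangle_ineq4) simp
    also have "\<dots> \<le> 2 * (norm p)\<^sup>2 + 2 * (norm q)\<^sup>2"
      using sum_squares_bound[of "norm p" "norm q"] by (simp add: power2_sum)
    finally show ?thesis .
  qed
  then show "AE x in M. norm ((norm (f x - g x))\<^sup>2) \<le> norm (2 * (norm (f x))\<^sup>2 + 2 * (norm (g x))\<^sup>2)"
    by (intro AE_I2) simp
qed measurable

text \<open>The quadratic polynomial \<open>s \<mapsto> \<integral>(f - s g)\<^sup>2\<close> is nonnegative; it is
  evaluated at its minimum, or, if it is affine, at a point where a nonzero slope would make it negative.\<close>

lemma Cauchy_Schwarz_integral:
  fixes f g :: "'a \<Rightarrow> real"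
  assumes "f \<in> borel_measurable M" "g \<in> borel_measurable M"
    and "integrable M (\<lambda>x. (f x)\<^sup>2)" "integrable M (\<lambda>x. (g x)\<^sup>2)"
  shows "(\<integral>x. f x * g x \<partial>M)\<^sup>2 \<le> (\<integral>x. (f x)\<^sup>2 \<partial>M) * (\<integral>x. (g x)\<^sup>2 \<partial>M)"
proof -
  let ?A = "\<integral>x. (f x)\<^sup>2 \<partial>M" and ?B = "\<integral>x. f x * g x \<partial>M" and ?C = "\<integral>x. (g x)\<^sup>2 \<partial>M"
  note int = integrable_mult_L2[OF assms] assms(3,4)
  have quad: "0 \<le> ?A - 2 * s * ?B + s\<^sup>2 * ?C" for s
  proof -
    have "0 \<le> (\<integral>x. (f x - s * g x)\<^sup>2 \<partial>M)" by simp
    also have "\<dots> = (\<integral>x. ((f x)\<^sup>2 - 2 * s * (f x * g x)) + s\<^sup>2 * (g x)\<^sup>2 \<partial>M)"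
      by (intro Bochner_Integration.integral_cong) (auto simp: power2_diff power_mult_distrib algebra_simps)
    also have "\<dots> = ?A - 2 * s * ?B + s\<^sup>2 * ?C"
      using int by simp
    finally show ?thesis .
  qed
  show ?thesis
  proof (cases "?C = 0")
    case True
    have "?B = 0"
    proof (rule ccontr)
      assume "?B \<noteq> 0"
      then show False
        using quad[of "(?A + 1) / (2 * ?B)"] True by simp
    qed
    then show ?thesis using True by simp
  next
    case False
    then have "0 < ?C" by (simp add: less_le)
    then show ?thesis
      using quad[of "?B / ?C"] by (simp add: field_simps power2_eq_square)
  qed
qed

text \<open>Strong convergence in \<open>L\<^sup>2\<close> implies weak convergence. This is how identities for test
  functions are carried over to their limits in \<open>H10_space\<close>.\<close>

lemma integral_mult_tendsto_L2:
  fixes f w :: "'a \<Rightarrow> real"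
  assumes w: "w \<in> borel_measurable M" "integrable M (\<lambda>x. (w x)\<^sup>2)"
    and f: "f \<in> borel_measurable M" "integrable M (\<lambda>x. (f x)\<^sup>2)"
    and F: "\<And>n::nat. F n \<in> borel_measurable M" "\<And>n. integrable M (\<lambda>x. (F n x)\<^sup>2)"
    and lim: "(\<lambda>n. \<integral>x. (F n x - f x)\<^sup>2 \<partial>M) \<longlonglongrightarrow> 0"
  shows "(\<lambda>n. \<integral>x. w x * F n x \<partial>M) \<longlonglongrightarrow> (\<integral>x. w x * f x \<partial>M)"
proof -
  have d: "(\<lambda>x. F n x - f x) \<in> borel_measurable M" "integrable M (\<lambda>x. (F n x - f x)\<^sup>2)" for n
    using F[of n] f integrable_diff_L2[of "F n" M f] by auto
  have "(\<lambda>n. (\<integral>x. w x * F n x \<partial>M) - (\<integral>x. w x * f x \<partial>M)) \<longlonglongrightarrow> 0"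
  proof (rule Lim_null_comparison[OF always_eventually, OF allI])
    fix n
    have "(\<integral>x. w x * F n x \<partial>M) - (\<integral>x. w x * f x \<partial>M) = (\<integral>x. w x * (F n x - f x) \<partial>M)"
      using integrable_mult_L2[of w M f] integrable_mult_L2[of w M "F n"] w f F[of n]
      by (simp add: right_diff_distrib)
    then have "((\<integral>x. w x * F n x \<partial>M) - (\<integral>x. w x * f x \<partial>M))\<^sup>2
        \<le> (\<integral>x. (w x)\<^sup>2 \<partial>M) * (\<integral>x. (F n x - f x)\<^sup>2 \<partial>M)"
      using Cauchy_Schwarz_integral[OF w(1) d(1)[of n] w(2) d(2)] by simp
    then show "norm ((\<integral>x. w x * F n x \<partial>M) - (\<integral>x. w x * f x \<partial>M))
        \<le> sqrt ((\<integral>x. (w x)\<^sup>2 \<partial>M) * (\<integral>x. (F n x - f x)\<^sup>2 \<partial>M))"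
      by (simp add: real_le_rsqrt)
  next
    show "(\<lambda>n. sqrt ((\<integral>x. (w x)\<^sup>2 \<partial>M) * (\<integral>x. (F n x - f x)\<^sup>2 \<partial>M))) \<longlonglongrightarrow> 0"
      using tendsto_real_sqrt[OF tendsto_mult_left[OF lim]] by simp
  qed
  then show ?thesis by (simp add: LIM_zero_iff)
qed

lemma set_integral_eq_lebesgue_on:
  fixes f :: "'a::euclidean_space \<Rightarrow> real"
  assumes "\<Omega> \<in> sets lebesgue"
  shows "(LINT x:\<Omega>|lebesgue. f x) = (\<integral>x. f x \<partial>lebesgue_on \<Omega>)"
  unfolding set_lebesgue_integral_def using assms by (intro integral_restrict_space[symmetric]) simp

text \<open>Passing to the restricted measure makes the lemmas on square-integrable functions over an abstract
  measure space applicable.\<close>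

lemma L2_space_iff:
  fixes f :: "'a::euclidean_space \<Rightarrow> 'b::euclidean_space"
  assumes "\<Omega> \<in> sets lebesgue"
  shows "f \<in> L2_space \<Omega> \<longleftrightarrow>
    f \<in> borel_measurable (lebesgue_on \<Omega>) \<and> integrable (lebesgue_on \<Omega>) (\<lambda>x. (norm (f x))\<^sup>2)"
  using assms
  by (simp add: L2_space_def set_borel_measurable_def set_integrable_def
      borel_measurable_restrict_space_iff integrable_restrict_space)

lemma set_integral_zero_outside:
  fixes f :: "'a::euclidean_space \<Rightarrow> real"
  assumes "\<And>x. x \<notin> \<Omega> \<Longrightarrow> f x = 0"
  shows "(LINT x:\<Omega>|lebesgue. f x) = (\<integral>x. f x \<partial>lebesgue)"
  unfolding set_lebesgue_integral_def
  by (intro Bochner_Integration.integral_cong) (use assms in \<open>auto simp: indicator_def\<close>)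

section \<open>Test functions in the Sobolev space\<close>

lemma integrable_continuous_bounded_support:
  fixes f :: "'a::euclidean_space \<Rightarrow> real"
  assumes cont: "continuous_on UNIV f" and supp: "bounded {x. f x \<noteq> 0}"
  shows "integrable lebesgue f"
proof -
  have "f \<in> borel_measurable borel"
    using cont by (rule borel_measurable_continuous_onI)
  moreover obtain M where "\<And>x. \<bar>f x\<bar> \<le> M"
    using compact_support_bounded[OF cont supp] by blast
  moreover obtain R where "\<And>x. f x \<noteq> 0 \<Longrightarrow> norm x \<le> R"
    using supp by (auto simp: bounded_iff)
  ultimately have "integrable lborel f"
    by (intro integrable_bounded_support[of f M R]) (auto simp: not_le[symmetric])
  then show ?thesis
    using \<open>f \<in> borel_measurable borel\<close> by (simp add: integrable_completion)
qed

lemma integrable_lebesgue_on: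
  fixes f :: "'a::euclidean_space \<Rightarrow> real"
  assumes "integrable lebesgue f" "\<Omega> \<in> sets lebesgue"
  shows "integrable (lebesgue_on \<Omega>) f"
  using assms integrable_mult_indicator[of \<Omega> lebesgue f] by (simp add: integrable_restrict_space)

lemma test_function_mult_integrable:
  assumes "\<phi> \<in> test_functions \<Omega>" "\<psi> \<in> test_functions \<Omega>"
  shows "integrable lebesgue (\<lambda>x. \<phi> x * \<psi> x)"
proof (rule integrable_continuous_bounded_support)
  show "continuous_on UNIV (\<lambda>x. \<phi> x * \<psi> x)"
    using assms by (intro continuous_on_mult test_function_continuous)
  show "bounded {x. \<phi> x * \<psi> x \<noteq> 0}"
    by (rule bounded_subset[OF test_function_support_bounded[OF assms(1)]]) auto
qed

lemma test_function_integration_by_parts: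
  assumes \<phi>: "\<phi> \<in> test_functions \<Omega>" and \<psi>: "\<psi> \<in> test_functions \<Omega>" and b: "b \<in> Basis"
  shows "(LINT x:\<Omega>|lebesgue. \<phi> x * partial_deriv b \<psi> x)
    = - (LINT x:\<Omega>|lebesgue. partial_deriv b \<phi> x * \<psi> x)"
proof -
  note \<phi>' = partial_deriv_test_function[OF \<phi> b] and \<psi>' = partial_deriv_test_function[OF \<psi> b]
  obtain A where A: "\<And>x. \<bar>\<phi> x\<bar> \<le> A" using test_function_bounded[OF \<phi>] by blast
  obtain B where B: "\<And>x. \<bar>\<psi> x\<bar> \<le> B" using test_function_bounded[OF \<psi>] by blast
  obtain A' where A': "\<And>x. \<bar>partial_deriv b \<phi> x\<bar> \<le> A'" using test_function_bounded[OF \<phi>'] by blast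
  obtain B' where B': "\<And>x. \<bar>partial_deriv b \<psi> x\<bar> \<le> B'" using test_function_bounded[OF \<psi>'] by blast
  let ?f' = "\<lambda>x v. \<phi> x * frechet_derivative \<psi> (at x) v + frechet_derivative \<phi> (at x) v * \<psi> x"
  have "(\<integral>x. ?f' x b \<partial>lebesgue) = 0"
  proof (rule integral_derivative_eq_0)
    show "((\<lambda>x. \<phi> x * \<psi> x) has_derivative ?f' x) (at x)" for x
      using test_function_differentiable[OF \<phi>] test_function_differentiable[OF \<psi>]
      by (rule has_derivative_mult)
    show "\<bar>?f' x b\<bar> \<le> A * B' + A' * B" for x
      using A[of x] B[of x] A'[of x] B'[of x] unfolding partial_deriv_def
      by (intro order_trans[OF abs_triangle_ineq] add_mono) (auto simp: abs_mult intro!: mult_mono)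
    show "bounded {x. \<phi> x * \<psi> x \<noteq> 0}"
      by (rule bounded_subset[OF test_function_support_bounded[OF \<phi>]]) auto
  qed (use b in simp)
  also have "(\<integral>x. ?f' x b \<partial>lebesgue)
      = (\<integral>x. \<phi> x * partial_deriv b \<psi> x \<partial>lebesgue) + (\<integral>x. partial_deriv b \<phi> x * \<psi> x \<partial>lebesgue)"
    unfolding partial_deriv_def[symmetric]
    using test_function_mult_integrable[OF \<phi> \<psi>'] test_function_mult_integrable[OF \<phi>' \<psi>]
    by (rule Bochner_Integration.integral_add)
  finally show ?thesis
    using test_function_zero[OF \<phi>] test_function_zero[OF \<psi>]
    by (subst (1 2) set_integral_zero_outside) auto
qed

lemma grad_inner_Basis:
  "b \<in> Basis \<Longrightarrow> grad f x \<bullet> b = partial_deriv b f x"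
  unfolding grad_def by (rule inner_sum_left_Basis)

lemma norm_grad_squared: "(norm (grad f x))\<^sup>2 = (\<Sum>b\<in>Basis. (partial_deriv b f x)\<^sup>2)"
  unfolding power2_norm_eq_inner euclidean_inner[of "grad f x" "grad f x"]
  by (intro sum.cong) (simp_all add: grad_inner_Basis power2_eq_square)

lemma test_function_L2:
  assumes \<Omega>: "\<Omega> \<in> sets lebesgue" and \<phi>: "\<phi> \<in> test_functions \<Omega>"
  shows "\<phi> \<in> L2_space \<Omega>" and "grad \<phi> \<in> L2_space \<Omega>"
proof -
  have sq: "integrable (lebesgue_on \<Omega>) (\<lambda>x. (\<psi> x)\<^sup>2)" if "\<psi> \<in> test_functions \<Omega>" for \<psi>
    using test_function_mult_integrable[OF that that] \<Omega> unfolding power2_eq_square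
    by (rule integrable_lebesgue_on)
  have meas: "\<psi> \<in> borel_measurable (lebesgue_on \<Omega>)" if "\<psi> \<in> test_functions \<Omega>" for \<psi>
    using test_function_continuous[OF that] \<Omega> by (rule continuous_imp_measurable_on_sets_lebesgue)
  show "\<phi> \<in> L2_space \<Omega>"
    using sq[OF \<phi>] meas[OF \<phi>] \<Omega> by (simp add: L2_space_iff)
  have "grad \<phi> \<in> borel_measurable (lebesgue_on \<Omega>)"
    unfolding grad_def[abs_def]
    by (intro borel_measurable_sum borel_measurable_scaleR meas partial_deriv_test_function[OF \<phi>]) auto
  moreover have "integrable (lebesgue_on \<Omega>) (\<lambda>x. (norm (grad \<phi> x))\<^sup>2)"
    unfolding norm_grad_squared
    by (intro Bochner_Integration.integrable_sum sq partial_deriv_test_function[OF \<phi>])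
  ultimately show "grad \<phi> \<in> L2_space \<Omega>"
    using \<Omega> by (simp add: L2_space_iff)
qed

lemma test_function_weak_gradient:
  assumes \<Omega>: "\<Omega> \<in> sets lebesgue" and \<phi>: "\<phi> \<in> test_functions \<Omega>"
  shows "weak_gradient \<Omega> \<phi> (grad \<phi>)"
  using test_function_L2[OF \<Omega> \<phi>] test_function_integration_by_parts[OF \<phi>]
  by (simp add: weak_gradient_def grad_inner_Basis)

lemma test_function_H10:
  assumes \<Omega>: "\<Omega> \<in> sets lebesgue" and \<phi>: "\<phi> \<in> test_functions \<Omega>"
  shows "\<phi> \<in> H10_space \<Omega>"
  unfolding H10_space_def using test_function_weak_gradient[OF \<Omega> \<phi>] \<phi>
  by (auto intro!: exI[of _ "grad \<phi>"] exI[of _ "\<lambda>_. \<phi>"])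

section \<open>The energy of a ball is negative\<close>

text \<open>Along the multiples \<open>s \<phi>\<close> of a fixed nonnegative test function the energy is the
  quadratic polynomial \<open>s\<^sup>2 A / 2 - s I\<close>, whose slope at \<open>0\<close> is
  \<open>- I < 0\<close>.\<close>

lemma dirichlet_energy_ball_neg:
  fixes a :: "'a::euclidean_space"
  assumes r: "0 < r"
  shows "dirichlet_energy (ball a r) < 0"
proof -
  let ?B = "ball a r"
  have B: "?B \<in> sets lebesgue" by simp
  obtain \<phi> where test: "\<And>s. (\<lambda>x. s * \<phi> x) \<in> test_functions ?B"
    and nonneg: "\<And>x. 0 \<le> \<phi> x" and pos: "\<And>x. dist a x < r / 2 \<Longrightarrow> 0 < \<phi> x"
    using exists_positive_test_function[OF r] by blast
  have \<phi>: "\<phi> \<in> test_functions ?B" using test[of 1] by simp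
  define A where "A = (LINT x:?B|lebesgue. (norm (grad \<phi> x))\<^sup>2)"
  define I where "I = (LINT x:?B|lebesgue. \<phi> x)"
  have "A \<ge> 0" unfolding A_def set_lebesgue_integral_def by (intro Bochner_Integration.integral_nonneg) simp
  have "I > 0"
  proof -
    have int: "integrable lebesgue \<phi>"
      using test_function_continuous[OF \<phi>] test_function_support_bounded[OF \<phi>]
      by (rule integrable_continuous_bounded_support)
    have I: "I = (\<integral>x. \<phi> x \<partial>lebesgue)"
      unfolding I_def using test_function_zero[OF \<phi>] by (rule set_integral_zero_outside)
    have "(\<integral>x. \<phi> x \<partial>lebesgue) \<noteq> 0"
    proof
      assume "(\<integral>x. \<phi> x \<partial>lebesgue) = 0"
      then have "AE x in lebesgue. \<phi> x = 0"
        using integral_nonneg_eq_0_iff_AE[OF int] nonneg by simp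
      then have "AE x in lebesgue. x \<notin> ball a (r / 2)"
        by eventually_elim (use pos in fastforce)
      then have "ball a (r / 2) \<in> null_sets lebesgue"
        by (simp add: AE_iff_null_sets)
      then show False
        using r negligible_iff_null_sets[of "ball a (r / 2)"] open_not_negligible[of "ball a (r / 2)"] by auto
    qed
    then show ?thesis using I nonneg by (simp add: less_le)
  qed
  \<comment> \<open>the minimum is at \<open>I / A\<close>; adding \<open>1\<close> avoids the question whether \<open>A\<close> vanishes\<close>
  define s where "s = I / (A + 1)"
  have s: "0 < s" "s * A < I"
    using \<open>A \<ge> 0\<close> \<open>I > 0\<close> by (auto simp: s_def field_simps)
  let ?u = "\<lambda>x. s * \<phi> x"
  have "partial_deriv b ?u x = s * partial_deriv b \<phi> x" for b x
    using partial_deriv_eq[OF has_derivative_mult_right[OF test_function_differentiable[OF \<phi>], of s]]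
    by (simp add: partial_deriv_def)
  then have "(norm (grad ?u x))\<^sup>2 = s\<^sup>2 * (norm (grad \<phi> x))\<^sup>2" for x
    by (simp add: norm_grad_squared power_mult_distrib sum_distrib_left)
  then have energy: "1 / 2 * (LINT x:?B|lebesgue. (norm (grad ?u x))\<^sup>2) - (LINT x:?B|lebesgue. ?u x)
      = s * (s * A / 2 - I)"
    by (simp add: A_def I_def power2_eq_square algebra_simps)
  have "dirichlet_energy ?B \<le> ereal (s * (s * A / 2 - I))"
    unfolding dirichlet_energy_def energy[symmetric]
    using test_function_weak_gradient[OF B test[of s]] test_function_H10[OF B test[of s]]
    by (intro Inf_lower) blast
  also have "s * (s * A / 2 - I) < 0"
    using s \<open>I > 0\<close> by (intro mult_pos_neg) auto
  finally show ?thesis by (simp add: zero_ereal_def)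
qed

section \<open>A dual lower bound for the energy\<close>

text \<open>The integrand is the derivative of \<open>V \<phi>\<close>. The function \<open>V\<close> may jump across the
  boundary of \<open>\<Omega>\<close>, even where two parts of \<open>\<Omega>\<close> meet; since the support of
  \<open>\<phi>\<close> is a closed subset of \<open>\<Omega>\<close>, the product \<open>V \<phi>\<close> is nevertheless
  differentiable in the whole space, and its derivative integrates to zero. The identity expresses
  the integral of \<open>\<phi>\<close> by its derivative, with the weight \<open>- V\<close>.\<close>

lemma integral_test_function_eq_dual:
  fixes \<Omega> :: "'a::euclidean_space set"
  assumes \<Omega>: "\<Omega> \<in> sets lebesgue" and b: "b \<in> Basis"
    and V: "\<And>x. x \<in> \<Omega> \<Longrightarrow> (V has_derivative (\<lambda>v. v \<bullet> b)) (at x)"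
    and h: "\<And>x. x \<in> \<Omega> \<Longrightarrow> \<bar>V x\<bar> \<le> h"
    and \<phi>: "\<phi> \<in> test_functions \<Omega>"
  shows "(\<integral>x. V x * partial_deriv b \<phi> x + \<phi> x \<partial>lebesgue_on \<Omega>) = 0"
proof -
  let ?K = "closure {x. \<phi> x \<noteq> 0}"
  have K: "?K \<subseteq> \<Omega>" using \<phi> by (simp add: test_functions_def)
  note \<phi>' = partial_deriv_test_function[OF \<phi> b]
  obtain A where A: "0 \<le> A" "\<And>x. \<bar>\<phi> x\<bar> \<le> A" using test_function_bounded[OF \<phi>] by blast
  obtain A' where A': "0 \<le> A'" "\<And>x. \<bar>partial_deriv b \<phi> x\<bar> \<le> A'" using test_function_bounded[OF \<phi>'] by blast
  let ?f' = "\<lambda>x v. V x * frechet_derivative \<phi> (at x) v + (v \<bullet> b) * \<phi> x"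
  let ?g' = "\<lambda>x v. if x \<in> \<Omega> then ?f' x v else 0"
  have "(\<integral>x. ?g' x b \<partial>lebesgue) = 0"
  proof (rule integral_derivative_eq_0[where f = "\<lambda>x. V x * \<phi> x" and f' = ?g' and M = "\<bar>h\<bar> * A' + A"])
    show "((\<lambda>x. V x * \<phi> x) has_derivative ?g' x) (at x)" for x
    proof (cases "x \<in> \<Omega>")
      case True
      then show ?thesis
        using has_derivative_mult[OF V test_function_differentiable[OF \<phi>]] by simp
    next
      case False
      have "((\<lambda>x. V x * \<phi> x) has_derivative (\<lambda>_. 0)) (at x)"
        by (rule has_derivative_transform_within_open[of "\<lambda>_. 0" _ _ _ "- ?K"])
          (use False K closure_subset[of "{x. \<phi> x \<noteq> 0}"] in auto)
      with False show ?thesis by simp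
    qed
    show "\<bar>?g' x b\<bar> \<le> \<bar>h\<bar> * A' + A" for x
    proof (cases "x \<in> \<Omega>")
      case True
      have "\<bar>V x * partial_deriv b \<phi> x + \<phi> x\<bar> \<le> \<bar>V x\<bar> * \<bar>partial_deriv b \<phi> x\<bar> + \<bar>\<phi> x\<bar>"
        by (simp flip: abs_mult)
      also have "\<dots> \<le> \<bar>h\<bar> * A' + A"
        using h[OF True] A(2)[of x] A'(2)[of x] by (intro add_mono mult_mono) auto
      finally show ?thesis using True b by (simp add: partial_deriv_def)
    next
      case False
      then show ?thesis using A'(1) A(1) by simp
    qed
    show "bounded {x. V x * \<phi> x \<noteq> 0}"
      by (rule bounded_subset[OF test_function_support_bounded[OF \<phi>]]) auto
  qed (use b in simp)
  also have "(\<integral>x. ?g' x b \<partial>lebesgue) = (LINT x:\<Omega>|lebesgue. V x * partial_deriv b \<phi> x + \<phi> x)"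
    unfolding set_lebesgue_integral_def using b
    by (intro Bochner_Integration.integral_cong) (auto simp: partial_deriv_def)
  finally show ?thesis using \<Omega> by (simp add: set_integral_eq_lebesgue_on)
qed

text \<open>The inequality of arithmetic and geometric means has exactly the constants that the functional
  \<open>\<integral>|g|\<^sup>2 / 2 - \<integral>u\<close> calls for.\<close>

lemma integral_mult_le_half_squares:
  fixes f g :: "'a \<Rightarrow> real"
  assumes "f \<in> borel_measurable M" "g \<in> borel_measurable M"
    and "integrable M (\<lambda>x. (f x)\<^sup>2)" "integrable M (\<lambda>x. (g x)\<^sup>2)"
  shows "(\<integral>x. f x * g x \<partial>M) \<le> (\<integral>x. (f x)\<^sup>2 \<partial>M) / 2 + (\<integral>x. (g x)\<^sup>2 \<partial>M) / 2"
proof -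
  have "(\<integral>x. f x * g x \<partial>M) \<le> (\<integral>x. (f x)\<^sup>2 / 2 + (g x)\<^sup>2 / 2 \<partial>M)"
    using assms integrable_mult_L2[OF assms] sum_squares_bound
    by (intro integral_mono) (auto simp: field_simps)
  then show ?thesis using assms by simp
qed

text \<open>The equality almost everywhere of two weak gradients is replaced by their equality as functionals
  on test functions, which follows at once from the definition.\<close>

lemma weak_gradient_eq:
  assumes "weak_gradient \<Omega> u g" "weak_gradient \<Omega> u g'" "\<Omega> \<in> sets lebesgue"
    and "\<phi> \<in> test_functions \<Omega>" "b \<in> Basis"
  shows "(\<integral>x. (g x \<bullet> b) * \<phi> x \<partial>lebesgue_on \<Omega>) = (\<integral>x. (g' x \<bullet> b) * \<phi> x \<partial>lebesgue_on \<Omega>)"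
  using assms by (simp add: weak_gradient_def flip: set_integral_eq_lebesgue_on)

lemma L2_space_component:
  fixes g :: "'a::euclidean_space \<Rightarrow> 'a"
  assumes \<Omega>: "\<Omega> \<in> sets lebesgue" and g: "g \<in> L2_space \<Omega>" and b: "b \<in> Basis"
  shows "(\<lambda>x. g x \<bullet> b) \<in> borel_measurable (lebesgue_on \<Omega>)"
    and "integrable (lebesgue_on \<Omega>) (\<lambda>x. (g x \<bullet> b)\<^sup>2)"
    and "(\<integral>x. (g x \<bullet> b)\<^sup>2 \<partial>lebesgue_on \<Omega>) \<le> (\<integral>x. (norm (g x))\<^sup>2 \<partial>lebesgue_on \<Omega>)"
proof -
  have g: "g \<in> borel_measurable (lebesgue_on \<Omega>)" "integrable (lebesgue_on \<Omega>) (\<lambda>x. (norm (g x))\<^sup>2)"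
    using g \<Omega> by (simp_all add: L2_space_iff)
  have le: "(v \<bullet> b)\<^sup>2 \<le> (norm v)\<^sup>2" for v :: 'a
    using Basis_le_norm[OF b, of v] by (simp add: abs_le_square_iff[symmetric])
  show m: "(\<lambda>x. g x \<bullet> b) \<in> borel_measurable (lebesgue_on \<Omega>)"
    using g(1) by (intro borel_measurable_inner) auto
  show i: "integrable (lebesgue_on \<Omega>) (\<lambda>x. (g x \<bullet> b)\<^sup>2)"
    by (rule Bochner_Integration.integrable_bound[OF g(2)]) (use m le in auto)
  show "(\<integral>x. (g x \<bullet> b)\<^sup>2 \<partial>lebesgue_on \<Omega>) \<le> (\<integral>x. (norm (g x))\<^sup>2 \<partial>lebesgue_on \<Omega>)"
    using i g(2) le by (intro integral_mono) auto
qed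

text \<open>A one-dimensional form of the dual description of torsional rigidity: a field \<open>V b\<close> with
  divergence \<open>1\<close> yields \<open>\<integral>u = - \<integral>V (g' \<bullet> b) \<le> \<integral>V\<^sup>2 / 2 + \<integral>(g' \<bullet> b)\<^sup>2 / 2\<close>
  for the gradient \<open>g'\<close> that is the limit of gradients of test functions. This estimate plays
  the role of a Poincare inequality with constant \<open>h\<close>.

  The energy is evaluated with some weak gradient \<open>g\<close>, which need not be \<open>g'\<close>. But
  derivatives of test functions are test functions, so both have the same integrals against
  \<open>\<partial>\<^sub>b \<phi>\<^sub>n\<close>, and in the limit against \<open>g' \<bullet> b\<close>. Hence
  \<open>\<integral>(g' \<bullet> b)\<^sup>2 = \<integral>(g \<bullet> b) (g' \<bullet> b)\<close>, and \<open>g' \<bullet> b\<close> has at most the norm of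
  \<open>g \<bullet> b\<close>.\<close>

lemma dirichlet_energy_ge:
  fixes \<Omega> :: "'a::euclidean_space set"
  assumes \<Omega>: "\<Omega> \<in> lmeasurable" and b: "b \<in> Basis"
    and V: "\<And>x. x \<in> \<Omega> \<Longrightarrow> (V has_derivative (\<lambda>v. v \<bullet> b)) (at x)"
    and h: "\<And>x. x \<in> \<Omega> \<Longrightarrow> \<bar>V x\<bar> \<le> h"
  shows "ereal (- (h\<^sup>2 * measure lebesgue \<Omega> / 2)) \<le> dirichlet_energy \<Omega>"
proof -
  let ?N = "lebesgue_on \<Omega>"
  have meas: "\<Omega> \<in> sets lebesgue" using \<Omega> by (rule fmeasurableD)
  interpret N: finite_measure ?N
    using \<Omega> by (rule finite_measure_lebesgue_on)
  have "continuous_on \<Omega> V"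
    using V by (intro continuous_at_imp_continuous_on) (blast intro: has_derivative_continuous)
  then have Vm: "V \<in> borel_measurable ?N"
    using meas by (rule continuous_imp_measurable_on_sets_lebesgue)
  have Vsq: "(V x)\<^sup>2 \<le> h\<^sup>2" if "x \<in> \<Omega>" for x
    using h[OF that] by (simp add: abs_le_square_iff[symmetric])
  have V2: "integrable ?N (\<lambda>x. (V x)\<^sup>2)"
    using Vm Vsq by (intro N.integrable_const_bound[where B = "h\<^sup>2"] AE_I2) auto
  have "(\<integral>x. (V x)\<^sup>2 \<partial>?N) \<le> (\<integral>x. h\<^sup>2 \<partial>?N)"
    using V2 Vsq by (intro integral_mono) auto
  also have "\<dots> = h\<^sup>2 * measure lebesgue \<Omega>"
    using meas by (simp add: measure_restrict_space)
  finally have V_le: "(\<integral>x. (V x)\<^sup>2 \<partial>?N) \<le> h\<^sup>2 * measure lebesgue \<Omega>" .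
  show ?thesis
    unfolding dirichlet_energy_def
  proof (rule Inf_greatest, clarify)
    fix u g
    assume u: "u \<in> H10_space \<Omega>" and g: "weak_gradient \<Omega> u g"
    obtain g' \<phi> where g': "weak_gradient \<Omega> u g'" and \<phi>: "\<And>n::nat. \<phi> n \<in> test_functions \<Omega>"
      and lim: "(\<lambda>n. (LINT x:\<Omega>|lebesgue. (\<phi> n x - u x)\<^sup>2)
           + (LINT x:\<Omega>|lebesgue. (norm (grad (\<phi> n) x - g' x))\<^sup>2)) \<longlonglongrightarrow> 0"
      using u unfolding H10_space_def by blast
    have L2: "u \<in> L2_space \<Omega>" "g \<in> L2_space \<Omega>" "g' \<in> L2_space \<Omega>"
      using g g' by (simp_all add: weak_gradient_def)
    have um: "u \<in> borel_measurable ?N" "integrable ?N (\<lambda>x. (u x)\<^sup>2)"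
      using L2(1) meas by (simp_all add: L2_space_iff)
    have \<phi>m: "\<psi> \<in> borel_measurable ?N" "integrable ?N (\<lambda>x. (\<psi> x)\<^sup>2)" if "\<psi> \<in> test_functions \<Omega>" for \<psi>
      using test_function_L2(1)[OF meas that] meas by (simp_all add: L2_space_iff)
    note gb = L2_space_component[OF meas L2(2) b] and gb' = L2_space_component[OF meas L2(3) b]
    let ?d = "\<lambda>n. partial_deriv b (\<phi> n)"
    note d = partial_deriv_test_function[OF \<phi> b]
    have lim\<phi>: "(\<lambda>n. \<integral>x. (\<phi> n x - u x)\<^sup>2 \<partial>?N) \<longlonglongrightarrow> 0"
      by (rule real_tendsto_sandwich[OF _ _ tendsto_const lim])
        (simp_all add: set_integral_eq_lebesgue_on[OF meas])
    have limd: "(\<lambda>n. \<integral>x. (?d n x - g' x \<bullet> b)\<^sup>2 \<partial>?N) \<longlonglongrightarrow> 0"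
    proof (rule real_tendsto_sandwich[OF _ _ tendsto_const lim])
      have "(\<integral>x. (?d n x - g' x \<bullet> b)\<^sup>2 \<partial>?N) \<le> (\<integral>x. (norm (grad (\<phi> n) x - g' x))\<^sup>2 \<partial>?N)" for n
      proof -
        have "(\<lambda>x. grad (\<phi> n) x - g' x) \<in> L2_space \<Omega>"
          using test_function_L2(2)[OF meas \<phi>, of n] L2(3) meas
          by (auto simp: L2_space_iff intro: integrable_diff_L2)
        from L2_space_component(3)[OF meas this b] show ?thesis
          by (simp add: inner_diff_left grad_inner_Basis[OF b])
      qed
      moreover have "0 \<le> (\<integral>x. (\<phi> n x - u x)\<^sup>2 \<partial>?N)" for n by simp
      ultimately show "\<forall>\<^sub>F n in sequentially. (\<integral>x. (?d n x - g' x \<bullet> b)\<^sup>2 \<partial>?N) \<le>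
          (LINT x:\<Omega>|lebesgue. (\<phi> n x - u x)\<^sup>2) + (LINT x:\<Omega>|lebesgue. (norm (grad (\<phi> n) x - g' x))\<^sup>2)"
        by (intro always_eventually allI) (simp add: set_integral_eq_lebesgue_on[OF meas] add_increasing)
    qed simp
    have lim_u: "(\<lambda>n. \<integral>x. 1 * \<phi> n x \<partial>?N) \<longlonglongrightarrow> (\<integral>x. 1 * u x \<partial>?N)"
      using um \<phi>m[OF \<phi>] lim\<phi> by (intro integral_mult_tendsto_L2) auto
    have lim_V: "(\<lambda>n. \<integral>x. V x * ?d n x \<partial>?N) \<longlonglongrightarrow> (\<integral>x. V x * (g' x \<bullet> b) \<partial>?N)"
      using Vm V2 gb' \<phi>m[OF d] limd by (intro integral_mult_tendsto_L2) auto
    have dual: "(\<integral>x. V x * ?d n x \<partial>?N) + (\<integral>x. 1 * \<phi> n x \<partial>?N) = 0" for n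
    proof -
      have "integrable ?N (\<lambda>x. V x * ?d n x)"
        by (rule integrable_mult_L2[OF Vm \<phi>m(1)[OF d] V2 \<phi>m(2)[OF d]])
      moreover have "integrable ?N (\<lambda>x. 1 * \<phi> n x)"
        by (rule integrable_mult_L2[OF _ \<phi>m(1)[OF \<phi>] _ \<phi>m(2)[OF \<phi>]]) auto
      ultimately show ?thesis
        using integral_test_function_eq_dual[OF meas b V h \<phi>, of n] by simp
    qed
    have "(\<lambda>n. 0) \<longlonglongrightarrow> (\<integral>x. V x * (g' x \<bullet> b) \<partial>?N) + (\<integral>x. 1 * u x \<partial>?N)"
      using tendsto_add[OF lim_V lim_u] by (simp only: dual)
    then have "(\<integral>x. V x * (g' x \<bullet> b) \<partial>?N) + (\<integral>x. u x \<partial>?N) = 0"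
      by (simp add: LIMSEQ_const_iff)
    then have "(\<integral>x. u x \<partial>?N) = (\<integral>x. - V x * (g' x \<bullet> b) \<partial>?N)"
      by simp
    also have "\<dots> \<le> (\<integral>x. (- V x)\<^sup>2 \<partial>?N) / 2 + (\<integral>x. (g' x \<bullet> b)\<^sup>2 \<partial>?N) / 2"
      using Vm V2 gb' by (intro integral_mult_le_half_squares) auto
    finally have u_le: "(\<integral>x. u x \<partial>?N) \<le> (\<integral>x. (V x)\<^sup>2 \<partial>?N) / 2 + (\<integral>x. (g' x \<bullet> b)\<^sup>2 \<partial>?N) / 2"
      by simp
    have "(\<lambda>n. \<integral>x. (g x \<bullet> b) * ?d n x \<partial>?N) \<longlonglongrightarrow> (\<integral>x. (g x \<bullet> b) * (g' x \<bullet> b) \<partial>?N)"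
      using gb gb' \<phi>m[OF d] limd by (intro integral_mult_tendsto_L2) auto
    moreover have "(\<lambda>n. \<integral>x. (g' x \<bullet> b) * ?d n x \<partial>?N) \<longlonglongrightarrow> (\<integral>x. (g' x \<bullet> b) * (g' x \<bullet> b) \<partial>?N)"
      using gb' \<phi>m[OF d] limd by (intro integral_mult_tendsto_L2) auto
    \<comment> \<open>the two sequences coincide, because \<open>g\<close> and \<open>g'\<close> agree as functionals on test functions\<close>
    ultimately have "(\<integral>x. (g' x \<bullet> b) * (g' x \<bullet> b) \<partial>?N) = (\<integral>x. (g x \<bullet> b) * (g' x \<bullet> b) \<partial>?N)"
      using weak_gradient_eq[OF g g' meas d b] by (intro LIMSEQ_unique) auto
    also have "\<dots> \<le> (\<integral>x. (g x \<bullet> b)\<^sup>2 \<partial>?N) / 2 + (\<integral>x. (g' x \<bullet> b)\<^sup>2 \<partial>?N) / 2"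
      using gb gb' by (intro integral_mult_le_half_squares) auto
    finally have "(\<integral>x. (g' x \<bullet> b)\<^sup>2 \<partial>?N) \<le> (\<integral>x. (g x \<bullet> b)\<^sup>2 \<partial>?N)"
      by (simp add: power2_eq_square)
    with u_le V_le gb(3)
    have "- (h\<^sup>2 * measure lebesgue \<Omega> / 2) \<le> 1 / 2 * (\<integral>x. (norm (g x))\<^sup>2 \<partial>?N) - (\<integral>x. u x \<partial>?N)"
      by linarith
    then show "ereal (- (h\<^sup>2 * measure lebesgue \<Omega> / 2))
        \<le> ereal (1 / 2 * (LINT x:\<Omega>|lebesgue. (norm (g x))\<^sup>2) - (LINT x:\<Omega>|lebesgue. u x))"
      by (simp add: set_integral_eq_lebesgue_on[OF meas])
  qed
qed

section \<open>Slicing the ball\<close>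

definition slices :: "'a::euclidean_space \<Rightarrow> real \<Rightarrow> 'a set" where
  "slices b h = {x. x \<bullet> b / h \<in> \<int>}"

lemma closed_slices: "closed (slices b h)"
proof -
  have "slices b h = (\<lambda>x. x \<bullet> b * inverse h) -` \<int>"
    by (auto simp: slices_def divide_inverse)
  also have "closed \<dots>"
    by (intro closed_vimage closed_Ints continuous_intros)
  finally show ?thesis .
qed

lemma negligible_slices:
  assumes "b \<noteq> 0" "h \<noteq> 0"
  shows "negligible (slices b h)"
proof -
  have "slices b h = (\<Union>k::int. {x. b \<bullet> x = h * of_int k})"
    using assms by (auto simp: slices_def Ints_def field_simps inner_commute)
  moreover have "negligible (\<Union>k::int. {x. b \<bullet> x = h * of_int k})"
    using assms by (intro negligible_countable_Union countable_image) (auto intro: negligible_hyperplane)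
  ultimately show ?thesis by simp
qed

text \<open>Between consecutive hyperplanes the distance to the lower one serves as \<open>V\<close>: its derivative
  in direction \<open>b\<close> is \<open>1\<close> and it is bounded by the spacing.\<close>

lemma dirichlet_energy_sliced_ge:
  fixes \<Omega> :: "'a::euclidean_space set"
  assumes \<Omega>: "\<Omega> \<in> lmeasurable" and b: "b \<in> Basis" and h: "0 < h"
  shows "ereal (- (h\<^sup>2 * measure lebesgue \<Omega> / 2)) \<le> dirichlet_energy (\<Omega> - slices b h)"
proof -
  have null: "slices b h \<in> null_sets lebesgue"
    using negligible_slices[of b h] nonzero_Basis[OF b] h by (simp add: negligible_iff_null_sets)
  have "ereal (- (h\<^sup>2 * measure lebesgue (\<Omega> - slices b h) / 2)) \<le> dirichlet_energy (\<Omega> - slices b h)"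
  proof (rule dirichlet_energy_ge[OF _ b])
    show "\<Omega> - slices b h \<in> lmeasurable"
      using \<Omega> null by (intro fmeasurable_Diff) auto
    let ?V = "\<lambda>x. x \<bullet> b - h * of_int \<lfloor>x \<bullet> b / h\<rfloor>"
    show "(?V has_derivative (\<lambda>v. v \<bullet> b)) (at x)" if "x \<in> \<Omega> - slices b h" for x
      using that h by (auto simp: slices_def intro!: derivative_eq_intros continuous_intros)
    show "\<bar>?V x\<bar> \<le> h" for x
    proof -
      have "0 \<le> x \<bullet> b / h - of_int \<lfloor>x \<bullet> b / h\<rfloor>" "x \<bullet> b / h - of_int \<lfloor>x \<bullet> b / h\<rfloor> \<le> 1"
        by linarith+
      then have "\<bar>h * (x \<bullet> b / h - of_int \<lfloor>x \<bullet> b / h\<rfloor>)\<bar> \<le> h * 1"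
        unfolding abs_mult using h by (intro mult_mono) auto
      then show ?thesis using h by (simp add: right_diff_distrib)
    qed
  qed
  also have "measure lebesgue (\<Omega> - slices b h) = measure lebesgue \<Omega>"
    using null \<Omega> by (intro measure_Diff_null_set) auto
  finally show ?thesis .
qed

section \<open>Slicing lowers the functional\<close>

theorem proposition6p1:
  fixes a :: "'a::euclidean_space" and r :: real and \<gamma> :: real and \<epsilon> :: real
  assumes "DIM('a) \<ge> 2" and "r > 0" and "\<gamma> < 0" and "\<epsilon> > 0"
  shows "\<exists>\<Omega> :: 'a set. open \<Omega> \<and>
    emeasure lebesgue (sym_diff \<Omega> (ball a r)) < ennreal \<epsilon> \<and>
    emeasure lebesgue \<Omega> = emeasure lebesgue (ball a r) \<and>
    perimeter \<Omega> + ereal \<gamma> * dirichlet_energy \<Omega>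
      < perimeter (ball a r) + ereal \<gamma> * dirichlet_energy (ball a r)"
proof -
  let ?B = "ball a r"
  obtain b :: 'a where b: "b \<in> Basis" using nonempty_Basis by blast
  obtain \<eta> where "dirichlet_energy ?B < ereal \<eta>" "ereal \<eta> < 0"
    using ereal_dense2[OF dirichlet_energy_ball_neg[OF \<open>r > 0\<close>]] by blast
  then have \<eta>: "dirichlet_energy ?B < ereal \<eta>" "\<eta> < 0" by (simp_all add: zero_ereal_def)
  define m where "m = measure lebesgue ?B"
  have "m \<ge> 0" by (simp add: m_def)
  \<comment> \<open>the spacing solves \<open>- h\<^sup>2 (m + 1) / 2 = \<eta>\<close>, so that the lower bound for the sliced ball is above \<open>\<eta>\<close>\<close>
  define h where "h = sqrt (- 2 * \<eta> / (m + 1))"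
  have h: "0 < h" "\<eta> \<le> - (h\<^sup>2 * m / 2)"
    using \<eta>(2) \<open>m \<ge> 0\<close> by (auto simp: h_def field_simps)
  define \<Omega> where "\<Omega> = ?B - slices b h"
  have neg: "negligible (slices b h)" using b h by (intro negligible_slices) auto
  then have null: "slices b h \<in> null_sets lebesgue" by (simp add: negligible_iff_null_sets)
  have "open \<Omega>" unfolding \<Omega>_def by (intro open_Diff closed_slices open_ball)
  moreover have diff: "sym_diff \<Omega> ?B \<subseteq> slices b h" by (auto simp: \<Omega>_def)
  then have negd: "negligible (sym_diff \<Omega> ?B)" using neg by (rule negligible_subset[rotated])
  then have "emeasure lebesgue (sym_diff \<Omega> ?B) < ennreal \<epsilon>"
    using \<open>\<epsilon> > 0\<close> unfolding negligible_iff_null_sets by (simp add: null_setsD1)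
  moreover have "emeasure lebesgue \<Omega> = emeasure lebesgue ?B"
    unfolding \<Omega>_def using null by (intro emeasure_Diff_null_set) auto
  moreover have "perimeter \<Omega> + ereal \<gamma> * dirichlet_energy \<Omega> < perimeter ?B + ereal \<gamma> * dirichlet_energy ?B"
  proof -
    have "perimeter \<Omega> = perimeter ?B"
      using \<open>open \<Omega>\<close> negd by (intro perimeter_cong_null) auto
    moreover have "ereal \<eta> \<le> dirichlet_energy \<Omega>"
      using dirichlet_energy_sliced_ge[OF lmeasurable_ball b h(1), of a r] h(2)
      unfolding \<Omega>_def m_def[symmetric] by (meson ereal_less_eq(3) order_trans)
    then have "dirichlet_energy ?B < dirichlet_energy \<Omega>"
      using \<eta>(1) by (rule less_le_trans[rotated])
    then have "ereal \<gamma> * dirichlet_energy \<Omega> < ereal \<gamma> * dirichlet_energy ?B"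
      using \<open>\<gamma> < 0\<close> by (cases "dirichlet_energy ?B"; cases "dirichlet_energy \<Omega>") auto
    moreover have "ereal p + x < ereal p + y" if "x < y" for p x y
      using that by (cases x; cases y) auto
    moreover obtain p where "perimeter ?B = ereal p"
      using perimeter_ball_finite[OF \<open>r > 0\<close>, of a] by (cases "perimeter ?B") auto
    ultimately show ?thesis by simp
  qed
  ultimately show ?thesis by blast
qed

end
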